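(* Let $\boldsymbol{d}\in\Delta^N$ be any fixed location profile. The spatial channel selection game on the interference graph $G_{\boldsymbol{d}}$ (players $\mathcal{N}$, action set $\mathcal{M}$ for each player, payoff of player $n$ equal to $U_n(\boldsymbol{d},\boldsymbol{a})$) is a weighted potential game with potential function $$\Phi(\boldsymbol{d},\boldsymbol{a})=\sum_{i=1}^{N}-\log(1-p_{i})\left(\frac{1}{2}\sum_{j\in\mathcal{N}_{i}^{a_{i}}(\boldsymbol{d},\boldsymbol{a})}\log(1-p_{j})+\log\left(\theta_{a_{i}}B_{a_{i},d_{i}}^{i}p_{i}\right)\right)$$ and weights $w_i=-\log(1-p_i)$. That is, for every $n\in\mathcal{N}$, every $a_{-n}\in\mathcal{M}^{N-1}$ and all $a_n,a_n'\in\mathcal{M}$, $$\Phi(\boldsymbol{d},a_n',a_{-n})-\Phi(\boldsymbol{d},a_n,a_{-n})=w_n\left(U_n(\boldsymbol{d},a_n',a_{-n})-U_n(\boldsymbol{d},a_n,a_{-n})\right),\qquad w_n>0.$$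
   Context: Users $\mathcal{N}=\{1,\dots,N\}$; channels $\mathcal{M}=\{1,\dots,M\}$; $\Delta$ is a finite set of locations with a distance $\|\cdot,\cdot\|$; $\delta$ is the transmission range. For a location profile $\boldsymbol{d}=(d_1,\dots,d_N)\in\Delta^N$, the interference graph $G_{\boldsymbol{d}}$ is the undirected graph on $\mathcal{N}$ with an edge between distinct $i,j$ iff $\|d_i,d_j\|\le\delta$; $\mathcal{N}_n(\boldsymbol{d})$ is the set of neighbors of $n$ (so $n\notin\mathcal{N}_n(\boldsymbol{d})$). Parameters: channel availabilities $\theta_m\in(0,1)$; mean data rates $B_{m,d}^n>0$ of user $n$ on channel $m$ at location $d$; fixed contention probabilities $p_n\in(p_{\min},p_{\max})$ with $0<p_{\min}<p_{\max}<1$. For a channel profile $\boldsymbol{a}=(a_1,\dots,a_N)\in\mathcal{M}^N$, $\mathcal{N}_n^{a_n}(\boldsymbol{d},\boldsymbol{a})=\{i\in\mathcal{N}_n(\boldsymbol{d}):a_i=a_n\}$, and the utility of user $n$ is $$U_n(\boldsymbol{d},\boldsymbol{a})=\log\Big(\theta_{a_n}B_{a_n,d_n}^n p_n\prod_{i\in\mathcal{N}_n^{a_n}(\boldsymbol{d},\boldsymbol{a})}(1-p_i)\Big).$$ $(a_n',a_{-n})$ denotes the profile in which user $n$ plays $a_n'$ and the others play $a_{-n}$. *)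

theory Defs
  imports "HOL-Analysis.Analysis"
begin

text \<open>Strategic games are given by a player set \<open>I\<close>, action sets \<open>A i\<close> and payoffs \<open>u i\<close>.  Action
  profiles are functions in \<open>Pi\<^sub>E I A\<close>.  In the definition below, \<open>b\<close> is the profile of the
  opponents of \<open>n\<close>, so that \<open>b(n := x)\<close> is the full profile in which \<open>n\<close> plays \<open>x\<close>.\<close>

definition weighted_potential_game ::
  "'i set \<Rightarrow> ('i \<Rightarrow> 'c set) \<Rightarrow> ('i \<Rightarrow> ('i \<Rightarrow> 'c) \<Rightarrow> real) \<Rightarrow> (('i \<Rightarrow> 'c) \<Rightarrow> real) \<Rightarrow> ('i \<Rightarrow> real) \<Rightarrow> bool"
  where
  "weighted_potential_game I A u \<Phi> w \<longleftrightarrow>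
     (\<forall>n\<in>I. w n > 0 \<and>
        (\<forall>b \<in> Pi\<^sub>E (I - {n}) A. \<forall>x\<in>A n. \<forall>y\<in>A n.
           \<Phi> (b(n := y)) - \<Phi> (b(n := x)) = w n * (u n (b(n := y)) - u n (b(n := x)))))"

text \<open>In what follows users are \<open>{1..N}\<close> and \<open>dst\<close> is the distance on locations, \<open>\<delta>\<close> the transmission
  range, \<open>d\<close> a location profile, \<open>a\<close> a channel profile, \<open>\<theta> m\<close> the availability of channel \<open>m\<close>,
  \<open>B n m l\<close> the mean data rate of user \<open>n\<close> on channel \<open>m\<close> at location \<open>l\<close>, and \<open>p n\<close> the contention
  probability of user \<open>n\<close>.\<close>

definition interference_edges ::
  "nat \<Rightarrow> ('l \<Rightarrow> 'l \<Rightarrow> real) \<Rightarrow> real \<Rightarrow> (nat \<Rightarrow> 'l) \<Rightarrow> nat set set" where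
  "interference_edges N dst \<delta> d =
     {{i, j} | i j. i \<in> {1..N} \<and> j \<in> {1..N} \<and> i \<noteq> j \<and> dst (d i) (d j) \<le> \<delta>}"

definition neighbors ::
  "nat \<Rightarrow> ('l \<Rightarrow> 'l \<Rightarrow> real) \<Rightarrow> real \<Rightarrow> (nat \<Rightarrow> 'l) \<Rightarrow> nat \<Rightarrow> nat set" where
  "neighbors N dst \<delta> d n = {i \<in> {1..N}. {n, i} \<in> interference_edges N dst \<delta> d}"

definition cochannel_neighbors ::
  "nat \<Rightarrow> ('l \<Rightarrow> 'l \<Rightarrow> real) \<Rightarrow> real \<Rightarrow> (nat \<Rightarrow> 'l) \<Rightarrow> (nat \<Rightarrow> nat) \<Rightarrow> nat \<Rightarrow> nat set" where
  "cochannel_neighbors N dst \<delta> d a n = {i \<in> neighbors N dst \<delta> d n. a i = a n}"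

definition utility ::
  "nat \<Rightarrow> ('l \<Rightarrow> 'l \<Rightarrow> real) \<Rightarrow> real \<Rightarrow> (nat \<Rightarrow> real) \<Rightarrow> (nat \<Rightarrow> nat \<Rightarrow> 'l \<Rightarrow> real) \<Rightarrow> (nat \<Rightarrow> real) \<Rightarrow>
   (nat \<Rightarrow> 'l) \<Rightarrow> nat \<Rightarrow> (nat \<Rightarrow> nat) \<Rightarrow> real" where
  "utility N dst \<delta> \<theta> B p d n a =
     ln (\<theta> (a n) * B n (a n) (d n) * p n * (\<Prod>i\<in>cochannel_neighbors N dst \<delta> d a n. (1 - p i)))"

definition channel_potential ::
  "nat \<Rightarrow> ('l \<Rightarrow> 'l \<Rightarrow> real) \<Rightarrow> real \<Rightarrow> (nat \<Rightarrow> real) \<Rightarrow> (nat \<Rightarrow> nat \<Rightarrow> 'l \<Rightarrow> real) \<Rightarrow> (nat \<Rightarrow> real) \<Rightarrow>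
   (nat \<Rightarrow> 'l) \<Rightarrow> (nat \<Rightarrow> nat) \<Rightarrow> real" where
  "channel_potential N dst \<delta> \<theta> B p d a =
     (\<Sum>i = 1..N. - ln (1 - p i) *
        (1 / 2 * (\<Sum>j\<in>cochannel_neighbors N dst \<delta> d a i. ln (1 - p j))
         + ln (\<theta> (a i) * B i (a i) (d i) * p i)))"

end

theory Submission
  imports Defs
begin

text \<open>Each unordered pair \<open>{i, j}\<close> of co-channel neighbours contributes
  \<open>- ln (1 - p i) * ln (1 - p j)\<close> to the potential, the factor \<open>1 / 2\<close> compensating that the pair
  is counted twice.  The part of the potential that involves user \<open>n\<close> is therefore exactly
  \<open>- ln (1 - p n)\<close> times the utility of \<open>n\<close>, and the rest does not depend on the channel of \<open>n\<close>.\<close>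

text \<open>By symmetry row \<open>n\<close> and column \<open>n\<close> have equal sums, and the
  diagonal entry they share is zero; hence the factor 2. Applied to edge interactions, it cancels
  the \<open>1 / 2\<close> in the potential.\<close>

lemma sum_symmetric_isolate:
  fixes f :: "'i \<Rightarrow> 'i \<Rightarrow> 'b::comm_semiring_1"
  assumes "finite I" "n \<in> I" "f n n = 0" and sym: "\<And>i j. f i j = f j i"
  shows "(\<Sum>i\<in>I. \<Sum>j\<in>I. f i j) = 2 * (\<Sum>j\<in>I. f n j) + (\<Sum>i\<in>I - {n}. \<Sum>j\<in>I - {n}. f i j)"
proof -
  have row: "(\<Sum>j\<in>I. f i j) = f n i + (\<Sum>j\<in>I - {n}. f i j)" for i
    using assms(1,2) by (simp add: sum.remove[of I n] sym)
  have "(\<Sum>i\<in>I. \<Sum>j\<in>I. f i j) = (\<Sum>j\<in>I. f n j) + (\<Sum>i\<in>I - {n}. \<Sum>j\<in>I. f i j)"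
    using assms(1,2) by (rule sum.remove)
  also have "(\<Sum>i\<in>I - {n}. \<Sum>j\<in>I. f i j) =
      (\<Sum>i\<in>I - {n}. f n i) + (\<Sum>i\<in>I - {n}. \<Sum>j\<in>I - {n}. f i j)"
    by (subst row) (rule sum.distrib)
  \<comment> \<open>Since \<open>f n n = 0\<close>, the index \<open>n\<close> can be put back,
    which completes the second copy of the row.\<close>
  also have "(\<Sum>i\<in>I - {n}. f n i) = (\<Sum>i\<in>I. f n i)"
    using assms(1-3) by (simp add: sum.remove[of I n])
  finally show ?thesis
    by (simp add: mult_2 add.assoc)
qed

lemma interference_edges_irrefl: "{n, n} \<notin> interference_edges N dst \<delta> d"
  by (auto simp: interference_edges_def doubleton_eq_iff)

lemma cochannel_neighbors_subset: "cochannel_neighbors N dst \<delta> d a n \<subseteq> {1..N}"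
  by (auto simp: cochannel_neighbors_def neighbors_def)

text \<open>Moves the dependence on the channel profile from the index set into the summand, so that
  double sums range over a fixed square.\<close>

lemma sum_cochannel_neighbors:
  "(\<Sum>j\<in>cochannel_neighbors N dst \<delta> d a i. f j) =
     (\<Sum>j = 1..N. if {i, j} \<in> interference_edges N dst \<delta> d \<and> a j = a i then f j else 0)"
  unfolding cochannel_neighbors_def neighbors_def
  by (simp add: sum.inter_filter[symmetric])

lemma utility_eq_sum:
  assumes "\<theta> (a n) > 0" "B n (a n) (d n) > 0" "p n > 0" "\<And>i. i \<in> {1..N} \<Longrightarrow> p i < 1"
  shows "utility N dst \<delta> \<theta> B p d n a =
    ln (\<theta> (a n) * B n (a n) (d n) * p n) + (\<Sum>j\<in>cochannel_neighbors N dst \<delta> d a n. ln (1 - p j))"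
proof -
  let ?C = "cochannel_neighbors N dst \<delta> d a n"
  have pos: "1 - p j > 0" if "j \<in> ?C" for j
    using that assms(4) cochannel_neighbors_subset by fastforce
  moreover have "finite ?C"
    using cochannel_neighbors_subset by (rule finite_subset) simp
  ultimately have "ln (\<Prod>j\<in>?C. 1 - p j) = (\<Sum>j\<in>?C. ln (1 - p j))"
    by (intro ln_prod) (auto dest: less_imp_neq)
  moreover have "(\<Prod>j\<in>?C. 1 - p j) > 0"
    using pos by (rule prod_pos)
  ultimately show ?thesis
    using assms(1-3) by (simp add: utility_def ln_mult_pos)
qed

text \<open>This is the potential of the game with user \<open>n\<close> deleted; both indices avoid
  \<open>n\<close>, so the value \<open>a n\<close> is never read.\<close>

definition others_potential ::
  "nat \<Rightarrow> ('l \<Rightarrow> 'l \<Rightarrow> real) \<Rightarrow> real \<Rightarrow> (nat \<Rightarrow> real) \<Rightarrow> (nat \<Rightarrow> nat \<Rightarrow> 'l \<Rightarrow> real) \<Rightarrow> (nat \<Rightarrow> real) \<Rightarrow>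
   (nat \<Rightarrow> 'l) \<Rightarrow> nat \<Rightarrow> (nat \<Rightarrow> nat) \<Rightarrow> real" where
  "others_potential N dst \<delta> \<theta> B p d n a =
     (\<Sum>i\<in>{1..N} - {n}. - ln (1 - p i) * ln (\<theta> (a i) * B i (a i) (d i) * p i))
     - 1 / 2 * (\<Sum>i\<in>{1..N} - {n}. \<Sum>j\<in>{1..N} - {n}.
         if {i, j} \<in> interference_edges N dst \<delta> d \<and> a j = a i
         then ln (1 - p i) * ln (1 - p j) else 0)"

lemma others_potential_fun_upd:
  "others_potential N dst \<delta> \<theta> B p d n (a(n := x)) = others_potential N dst \<delta> \<theta> B p d n a"
  unfolding others_potential_def
  by (intro arg_cong2[where f = minus] arg_cong2[where f = times] sum.cong) auto

lemma channel_potential_isolate: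
  assumes n: "n \<in> {1..N}"
  shows "channel_potential N dst \<delta> \<theta> B p d a =
    - ln (1 - p n) * (ln (\<theta> (a n) * B n (a n) (d n) * p n) +
        (\<Sum>j\<in>cochannel_neighbors N dst \<delta> d a n. ln (1 - p j)))
    + others_potential N dst \<delta> \<theta> B p d n a"
proof -
  define L where "L i = ln (1 - p i)" for i
  define g where "g i = ln (\<theta> (a i) * B i (a i) (d i) * p i)" for i
  \<comment> \<open>The interaction is symmetric because the weight of \<open>i\<close> has the same
    form \<open>L i\<close>, up to sign, as the loss that \<open>i\<close> causes in the utility of
    a co-channel neighbor.\<close>
  define f where "f i j = (if {i, j} \<in> interference_edges N dst \<delta> d \<and> a j = a i
    then L i * L j else 0)" for i j
  have f_sum: "L i * (\<Sum>j\<in>cochannel_neighbors N dst \<delta> d a i. L j) = (\<Sum>j = 1..N. f i j)" for i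
    unfolding sum_cochannel_neighbors f_def sum_distrib_left by (intro sum.cong) auto
  have "f i j = f j i" for i j
    by (simp add: f_def insert_commute mult.commute eq_commute[of "a i"])
  moreover have "f n n = 0"
    \<comment> \<open>\<open>insert_absorb2\<close> would collapse \<open>{n, n}\<close> to
      \<open>{n}\<close> before the irreflexivity rule could match.\<close>
    by (simp add: f_def interference_edges_irrefl del: insert_absorb2)
  ultimately have double: "(\<Sum>i = 1..N. \<Sum>j = 1..N. f i j) =
      2 * (\<Sum>j = 1..N. f n j) + (\<Sum>i\<in>{1..N} - {n}. \<Sum>j\<in>{1..N} - {n}. f i j)"
    using n by (intro sum_symmetric_isolate) auto
  have "channel_potential N dst \<delta> \<theta> B p d a =
      (\<Sum>i = 1..N. - L i * g i - 1 / 2 * (\<Sum>j = 1..N. f i j))"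
    unfolding channel_potential_def L_def[symmetric] g_def[symmetric] f_sum[symmetric]
    by (intro sum.cong) (simp_all add: algebra_simps)
  also have "\<dots> = (\<Sum>i = 1..N. - L i * g i) - 1 / 2 * (\<Sum>i = 1..N. \<Sum>j = 1..N. f i j)"
    by (simp only: sum_subtractf sum_distrib_left)
  also have "(\<Sum>i = 1..N. - L i * g i) = - L n * g n + (\<Sum>i\<in>{1..N} - {n}. - L i * g i)"
    using n by (intro sum.remove) auto
  also note double
  finally show ?thesis
    unfolding others_potential_def L_def[symmetric] g_def[symmetric] f_def[symmetric]
      distrib_left mult_minus_left f_sum
    by simp
qed

theorem lemma1:
  fixes N M :: nat
    and \<Delta> :: "'l set"
    and dst :: "'l \<Rightarrow> 'l \<Rightarrow> real"
    and \<delta> :: real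
    and \<theta> :: "nat \<Rightarrow> real"
    and B :: "nat \<Rightarrow> nat \<Rightarrow> 'l \<Rightarrow> real"
    and p :: "nat \<Rightarrow> real"
    and p_min p_max :: real
    and d :: "nat \<Rightarrow> 'l"
  assumes "finite \<Delta>"
    and "Metric_space \<Delta> dst"
    and "\<And>m. m \<in> {1..M} \<Longrightarrow> \<theta> m \<in> {0<..<1}"
    and "\<And>n m l. n \<in> {1..N} \<Longrightarrow> m \<in> {1..M} \<Longrightarrow> l \<in> \<Delta> \<Longrightarrow> B n m l > 0"
    and "0 < p_min" and "p_min < p_max" and "p_max < 1"
    and "\<And>n. n \<in> {1..N} \<Longrightarrow> p n \<in> {p_min<..<p_max}"
    and "d \<in> {1..N} \<rightarrow>\<^sub>E \<Delta>"
  shows "weighted_potential_game {1..N} (\<lambda>_. {1..M})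
           (utility N dst \<delta> \<theta> B p d)
           (channel_potential N dst \<delta> \<theta> B p d)
           (\<lambda>i. - ln (1 - p i))"
proof -
  have p01: "0 < p i" "p i < 1" if "i \<in> {1..N}" for i
    using assms(8)[OF that] assms(5,7) by auto
  \<comment> \<open>The remainder is taken at \<open>b\<close>, not at \<open>b(n := x)\<close>: it
    is the same for every \<open>x\<close> and cancels when two channels of \<open>n\<close> are
    compared.\<close>
  have split: "channel_potential N dst \<delta> \<theta> B p d (b(n := x)) =
      - ln (1 - p n) * utility N dst \<delta> \<theta> B p d n (b(n := x)) + others_potential N dst \<delta> \<theta> B p d n b"
    if n: "n \<in> {1..N}" and x: "x \<in> {1..M}" for b n x
  proof -
    have "B n x (d n) > 0"
      using assms(4)[OF n x] assms(9) n by blast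
    then have "utility N dst \<delta> \<theta> B p d n (b(n := x)) =
        ln (\<theta> x * B n x (d n) * p n) +
        (\<Sum>j\<in>cochannel_neighbors N dst \<delta> d (b(n := x)) n. ln (1 - p j))"
      using assms(3)[OF x] p01 n by (subst utility_eq_sum) auto
    then show ?thesis
      using channel_potential_isolate[OF n, of dst \<delta> \<theta> B p d "b(n := x)"]
      by (simp add: others_potential_fun_upd)
  qed
  \<comment> \<open>Here \<open>1 - p n\<close> lies strictly between 0 and 1, so its logarithm is
    negative.\<close>
  have "- ln (1 - p n) > 0" if "n \<in> {1..N}" for n
    using p01[OF that] by simp
  then show ?thesis
    by (auto simp: weighted_potential_game_def split algebra_simps)
qed

end
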